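(* Let $T>0$ and let $\{X(t),t\in[0,T]\}$ be a stochastic process that is multifractal in the moment sense with scaling function $\tau$. If for some $q<0$ one has $E|X(T)|^q<\infty$ and $\tau(q)<1$, then almost every sample path of $\{X(t)\}$ is nowhere Hölder continuous of order $\gamma$ for every $$\gamma\in\left(\frac{\tau(q)}{q}-\frac1q,\ +\infty\right).$$ In particular, for almost every sample path $$H(t)\le\widetilde{H^+}\qquad\text{for each } t\in[0,T],$$ where $H(t)$ is the pointwise Hölder exponent of the path at $t$ and $$\widetilde{H^+}=\inf\left\{\frac{\tau(q)}{q}-\frac1q:\ q\in(\underline q,0),\ \tau(q)<1\right\}.$$
   Context: All processes are real-valued, measurable, separable, not a.s. constant, and stochastically continuous at zero, i.e. $P(|X(h)|>\varepsilon)\to0$ as $h\to0$ for every $\varepsilon>0$. Let $\overline q=\sup\{q>0:E|X(T)|^q<\infty\}$ and $\underline q=\inf\{q<0:E|X(T)|^q<\infty\}$ (set equal to $0$ if the corresponding set is empty). The process is multifractal in the moment sense if there exist functions $c(q)$ and $\tau(q)$ on $\mathfrak{Q}=(\underline q,\overline q)$, an interval of positive length, such that $$E|X(t)-X(s)|^q=c(q)|t-s|^{\tau(q)}\quad\text{for all } t,s\in[0,T],\ t\ne s,\ q\in\mathfrak{Q};$$ $\tau$ is called the scaling function. In the claim $q$ is understood to belong to $\mathfrak{Q}$, so that $\tau(q)$ is defined. A function $f:[0,T]\to\mathbb{R}$ is $C^{\gamma}(t_0)$ if there is $C>0$ such that $|f(t)-f(t_0)|\le C|t-t_0|^{\gamma}$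 for all $t\in[0,T]$ in some neighbourhood of $t_0$; $f$ is nowhere Hölder continuous of order $\gamma$ if $f\notin C^{\gamma}(t_0)$ for every $t_0\in[0,T]$. The pointwise Hölder exponent is $H(t_0)=\sup\{\gamma\ge0:f\in C^{\gamma}(t_0)\}$ with $\sup\emptyset=0$. For $q<0$, $0^q=+\infty$. *)

theory Defs
  imports "HOL-Probability.Probability"
begin

text \<open>Processes on \<open>[0,T]\<close> are maps \<open>X :: real \<Rightarrow> 'a \<Rightarrow> real\<close> of which only the values at times in
  \<open>{0..T}\<close> are used.\<close>

definition measurable_process :: "'a measure \<Rightarrow> real \<Rightarrow> (real \<Rightarrow> 'a \<Rightarrow> real) \<Rightarrow> bool" where
  "measurable_process M T X \<longleftrightarrow>
     (\<lambda>(t, \<omega>). X t \<omega>) \<in> borel_measurable (restrict_space borel {0..T} \<Otimes>\<^sub>M M)"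

text \<open>Separability in the sense of Doob, relative to the class of closed sets.\<close>

definition separable_process :: "'a measure \<Rightarrow> real \<Rightarrow> (real \<Rightarrow> 'a \<Rightarrow> real) \<Rightarrow> bool" where
  "separable_process M T X \<longleftrightarrow>
     (\<exists>S. countable S \<and> S \<subseteq> {0..T} \<and> {0..T} \<subseteq> closure S \<and>
        (AE \<omega> in M. \<forall>a b C. closed C \<longrightarrow>
           (\<forall>t \<in> {a<..<b} \<inter> S. X t \<omega> \<in> C) \<longrightarrow> (\<forall>t \<in> {a<..<b} \<inter> {0..T}. X t \<omega> \<in> C)))"

definition as_constant_process :: "'a measure \<Rightarrow> real \<Rightarrow> (real \<Rightarrow> 'a \<Rightarrow> real) \<Rightarrow> bool" where
  "as_constant_process M T X \<longleftrightarrow> (\<exists>c. AE \<omega> in M. \<forall>t\<in>{0..T}. X t \<omega> = c)"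

definition stoch_continuous_at_zero :: "'a measure \<Rightarrow> real \<Rightarrow> (real \<Rightarrow> 'a \<Rightarrow> real) \<Rightarrow> bool" where
  "stoch_continuous_at_zero M T X \<longleftrightarrow>
     (\<forall>\<epsilon>>0. ((\<lambda>h. measure M {\<omega> \<in> space M. \<bar>X h \<omega>\<bar> > \<epsilon>}) \<longlongrightarrow> 0) (at 0 within {0..T}))"

text \<open>\<open>\<bar>x\<bar>\<close> to the power \<open>q\<close>, with \<open>0\<close> to a negative power being \<open>\<infinity>\<close>. This differs from \<open>powr\<close>,
  which is \<open>0\<close> at base \<open>0\<close> for every exponent (also for exponent \<open>0\<close>).\<close>

definition abs_pow :: "real \<Rightarrow> real \<Rightarrow> ennreal" where
  "abs_pow x q =
     (if x = 0 then (if q < 0 then \<infinity> else if q = 0 then 1 else 0) else ennreal (\<bar>x\<bar> powr q))"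

definition abs_moment :: "'a measure \<Rightarrow> ('a \<Rightarrow> real) \<Rightarrow> real \<Rightarrow> ennreal" where
  "abs_moment M Y q = (\<integral>\<^sup>+ \<omega>. abs_pow (Y \<omega>) q \<partial>M)"

definition upper_q :: "'a measure \<Rightarrow> real \<Rightarrow> (real \<Rightarrow> 'a \<Rightarrow> real) \<Rightarrow> ereal" where
  "upper_q M T X =
     (let Q = {q. 0 < q \<and> abs_moment M (X T) q < \<infinity>} in if Q = {} then 0 else Sup (ereal ` Q))"

definition lower_q :: "'a measure \<Rightarrow> real \<Rightarrow> (real \<Rightarrow> 'a \<Rightarrow> real) \<Rightarrow> ereal" where
  "lower_q M T X =
     (let Q = {q. q < 0 \<and> abs_moment M (X T) q < \<infinity>} in if Q = {} then 0 else Inf (ereal ` Q))"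

definition moment_range :: "'a measure \<Rightarrow> real \<Rightarrow> (real \<Rightarrow> 'a \<Rightarrow> real) \<Rightarrow> real set" where
  "moment_range M T X = {q. lower_q M T X < ereal q \<and> ereal q < upper_q M T X}"

text \<open>The factor \<open>c\<close> is real-valued, so all moments of increments involved are finite. The condition
  \<open>0 \<le> c q\<close> is there because \<^const>\<open>ennreal\<close> truncates negative numbers to \<open>0\<close>.\<close>

definition multifractal_with ::
  "'a measure \<Rightarrow> real \<Rightarrow> (real \<Rightarrow> 'a \<Rightarrow> real) \<Rightarrow> (real \<Rightarrow> real) \<Rightarrow> bool" where
  "multifractal_with M T X \<tau> \<longleftrightarrow>
     lower_q M T X < upper_q M T X \<and>
     (\<exists>c :: real \<Rightarrow> real. \<forall>q \<in> moment_range M T X. 0 \<le> c q \<and>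
        (\<forall>t\<in>{0..T}. \<forall>s\<in>{0..T}. t \<noteq> s \<longrightarrow>
           abs_moment M (\<lambda>\<omega>. X t \<omega> - X s \<omega>) q = ennreal (c q * \<bar>t - s\<bar> powr \<tau> q)))"

definition holder_at :: "real \<Rightarrow> (real \<Rightarrow> real) \<Rightarrow> real \<Rightarrow> real \<Rightarrow> bool" where
  "holder_at T f \<gamma> t0 \<longleftrightarrow>
     (\<exists>C>0. \<exists>\<delta>>0. \<forall>t\<in>{0..T}. \<bar>t - t0\<bar> < \<delta> \<longrightarrow> \<bar>f t - f t0\<bar> \<le> C * \<bar>t - t0\<bar> powr \<gamma>)"

definition nowhere_holder :: "real \<Rightarrow> (real \<Rightarrow> real) \<Rightarrow> real \<Rightarrow> bool" where
  "nowhere_holder T f \<gamma> \<longleftrightarrow> (\<forall>t0\<in>{0..T}. \<not> holder_at T f \<gamma> t0)"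

definition holder_exponent :: "real \<Rightarrow> (real \<Rightarrow> real) \<Rightarrow> real \<Rightarrow> ereal" where
  "holder_exponent T f t0 =
     (let G = {\<gamma>. 0 \<le> \<gamma> \<and> holder_at T f \<gamma> t0} in if G = {} then 0 else Sup (ereal ` G))"

definition H_plus_tilde ::
  "'a measure \<Rightarrow> real \<Rightarrow> (real \<Rightarrow> 'a \<Rightarrow> real) \<Rightarrow> (real \<Rightarrow> real) \<Rightarrow> ereal" where
  "H_plus_tilde M T X \<tau> =
     Inf {ereal (\<tau> q / q - 1 / q) | q. lower_q M T X < ereal q \<and> q < 0 \<and> \<tau> q < 1}"

end

theory Submission
  imports Defs "HOL-Real_Asymp.Real_Asymp"
begin

text \<open>If a path is Hoelder of order \<open>\<gamma>\<close> at some point, then for every large \<open>n\<close> one of the \<open>n\<close>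
  increments over the uniform grid of mesh \<open>T / n\<close> is at most a constant times \<open>n powr - \<gamma>\<close>.
  Markov's inequality for the negative moment bounds the probability of this event by a constant
  times \<open>n powr (1 - \<tau> q + \<gamma> * q)\<close>, which tends to \<open>0\<close> because \<open>\<gamma> > (\<tau> q - 1) / q\<close>. Countable
  unions over the Hoelder constants and exponents give the claim.\<close>

section \<open>Fixed-time measurability and Markov's inequality for negative moments\<close>

lemma measurable_process_at:
  assumes "measurable_process M T X" and "t \<in> {0..T}"
  shows "X t \<in> borel_measurable M"
proof -
  have "(\<lambda>\<omega>. (t, \<omega>)) \<in> M \<rightarrow>\<^sub>M restrict_space borel {0..T} \<Otimes>\<^sub>M M"
    using assms(2) by (intro measurable_Pair) (auto simp: space_restrict_space)
  from measurable_compose[OF this assms(1)[unfolded measurable_process_def]]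
  show ?thesis by simp
qed

text \<open>Markov's inequality applied to \<open>abs_pow (Y \<omega>) q\<close>: since
  \<open>q < 0\<close>, small values of \<open>\<bar>Y \<omega>\<bar>\<close> correspond to large
  values of this power. Zeros of \<open>Y\<close> are counted as well, because
  \<open>abs_pow 0 q\<close> is infinite; with plain \<open>powr\<close> they would contribute
  \<open>0\<close> and the bound could fail.\<close>

lemma emeasure_abs_le_abs_moment:
  assumes [measurable]: "Y \<in> borel_measurable M" and "q < 0" and "0 < \<epsilon>"
  shows "emeasure M {\<omega> \<in> space M. \<bar>Y \<omega>\<bar> \<le> \<epsilon>} \<le> ennreal (\<epsilon> powr - q) * abs_moment M Y q"
proof -
  have [measurable]: "(\<lambda>\<omega>. abs_pow (Y \<omega>) q) \<in> borel_measurable M"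
    unfolding abs_pow_def by measurable
  have "1 \<le> ennreal (\<epsilon> powr - q) * abs_pow y q" if "\<bar>y\<bar> \<le> \<epsilon>" for y
  proof (cases "y = 0")
    case True
    then show ?thesis using assms by (simp add: abs_pow_def ennreal_mult_top)
  next
    case False
    have "1 = \<epsilon> powr - q * \<epsilon> powr q"
      using \<open>0 < \<epsilon>\<close> by (simp flip: powr_add)
    also have "\<dots> \<le> \<epsilon> powr - q * \<bar>y\<bar> powr q"
      using False that \<open>q < 0\<close> by (intro mult_left_mono powr_mono2') auto
    finally show ?thesis
      using False by (simp add: abs_pow_def ennreal_mult'[symmetric])
  qed
  then have "emeasure M {\<omega> \<in> space M. \<bar>Y \<omega>\<bar> \<le> \<epsilon>}
      \<le> emeasure M {\<omega> \<in> space M. 1 \<le> ennreal (\<epsilon> powr - q) * abs_pow (Y \<omega>) q}"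
    by (intro emeasure_mono) auto
  also have "\<dots> = emeasure M ({\<omega> \<in> space M. 1 \<le> ennreal (\<epsilon> powr - q) * abs_pow (Y \<omega>) q} \<inter> space M)"
    by (intro arg_cong[where f = "emeasure M"]) auto
  also have "\<dots> \<le> ennreal (\<epsilon> powr - q) * (\<integral>\<^sup>+ \<omega>. abs_pow (Y \<omega>) q * indicator (space M) \<omega> \<partial>M)"
    using nn_integral_Markov_inequality[of "\<lambda>\<omega>. abs_pow (Y \<omega>) q" "space M" M] by simp
  also have "(\<integral>\<^sup>+ \<omega>. abs_pow (Y \<omega>) q * indicator (space M) \<omega> \<partial>M) = abs_moment M Y q"
    unfolding abs_moment_def by (intro nn_integral_cong) auto
  finally show ?thesis .
qed

section \<open>Pointwise Hoelder continuity and increments over uniform grids\<close>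

lemma uniform_grid_cell:
  fixes T t :: real and n :: nat
  assumes "0 < T" and "0 < n" and "t \<in> {0..T}"
  obtains k where "k < n" and "T * real k / n \<le> t" and "t \<le> T * real (Suc k) / n"
proof (cases "t = T")
  case True
  \<comment> \<open>The right endpoint lies in the last cell; the floor formula of the other case
    would give the inadmissible index \<open>n\<close> here.\<close>
  show thesis
    by (rule that[of "n - 1"]) (use assms True in \<open>auto simp: field_simps of_nat_diff\<close>)
next
  case False
  define k where "k = nat \<lfloor>t * n / T\<rfloor>"
  have "0 \<le> t * n / T" using assms by auto
  then have k: "real k \<le> t * n / T" "t * n / T < real k + 1"
    unfolding k_def by linarith+
  have "t * n / T < n" using assms False by (simp add: field_simps)
  then have "k < n" using k by linarith
  show thesis
    by (rule that[of k, OF \<open>k < n\<close>]) (use k assms in \<open>auto simp: field_simps\<close>)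
qed

lemma holder_at_mono:
  assumes "holder_at T f \<gamma> t0" and "\<gamma>' \<le> \<gamma>"
  shows "holder_at T f \<gamma>' t0"
proof -
  obtain C \<delta> where *: "C > 0" "\<delta> > 0"
    "\<And>t. t \<in> {0..T} \<Longrightarrow> \<bar>t - t0\<bar> < \<delta> \<Longrightarrow> \<bar>f t - f t0\<bar> \<le> C * \<bar>t - t0\<bar> powr \<gamma>"
    using assms(1) unfolding holder_at_def by blast
  \<comment> \<open>On a neighbourhood of radius at most \<open>1\<close> the power of the distance
    does not increase with the exponent, so the same \<open>C\<close> works for
    \<open>\<gamma>'\<close>.\<close>
  have "\<bar>f t - f t0\<bar> \<le> C * \<bar>t - t0\<bar> powr \<gamma>'" if "t \<in> {0..T}" "\<bar>t - t0\<bar> < min \<delta> 1" for t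
  proof -
    have "\<bar>f t - f t0\<bar> \<le> C * \<bar>t - t0\<bar> powr \<gamma>" using *(3) that by auto
    also have "\<dots> \<le> C * \<bar>t - t0\<bar> powr \<gamma>'"
      using *(1) that assms(2) by (intro mult_left_mono powr_mono') auto
    finally show ?thesis .
  qed
  then show ?thesis
    unfolding holder_at_def using *(1,2) by (intro exI[of _ C] conjI exI[of _ "min \<delta> 1"]) auto
qed

text \<open>Both endpoints of the grid cell containing \<open>t0\<close> are within
  \<open>T / n\<close> of \<open>t0\<close>, so the triangle inequality through \<open>t0\<close>
  bounds the increment over that cell. One natural number \<open>m\<close> serves both as the
  constant and as the threshold for \<open>n\<close>, which leaves a single countable parameter for
  the almost sure argument.\<close>

lemma holder_at_small_grid_increment:
  assumes "holder_at T f \<gamma> t0" and "t0 \<in> {0..T}" and "0 < \<gamma>" and "0 < T"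
  obtains m :: nat where "0 < m"
    and "\<And>n. m \<le> n \<Longrightarrow> \<exists>k<n. \<bar>f (T * real (Suc k) / n) - f (T * real k / n)\<bar> \<le> m * real n powr - \<gamma>"
proof -
  obtain C \<delta> where *: "C > 0" "\<delta> > 0"
    "\<And>t. t \<in> {0..T} \<Longrightarrow> \<bar>t - t0\<bar> < \<delta> \<Longrightarrow> \<bar>f t - f t0\<bar> \<le> C * \<bar>t - t0\<bar> powr \<gamma>"
    using assms(1) unfolding holder_at_def by blast
  \<comment> \<open>The entry \<open>1\<close> makes \<open>m\<close> positive,
    \<open>2 * C * T powr \<gamma>\<close> is the constant from the triangle inequality, and
    \<open>T / \<delta>\<close> forces the mesh \<open>T / n\<close> below
    \<open>\<delta>\<close>.\<close>
  obtain m :: nat where m: "max (max 1 (2 * C * T powr \<gamma>)) (T / \<delta>) < m"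
    using reals_Archimedean2 by blast
  show thesis
  proof (rule that[of m])
    show "0 < m" using m by (cases m) auto
    fix n assume "m \<le> n"
    then have n: "0 < n" "T / \<delta> < n" using m by (auto simp: \<open>0 < m\<close>)
    obtain k where k: "k < n" "T * real k / n \<le> t0" "t0 \<le> T * real (Suc k) / n"
      using uniform_grid_cell[OF \<open>0 < T\<close> \<open>0 < n\<close> assms(2)] by blast
    have mesh: "T * real (Suc k) / n = T * real k / n + T / n"
      by (simp add: distrib_left add_divide_distrib)
    have le_T: "T * real (Suc k) / n \<le> T"
      using k(1) n(1) assms by (simp add: field_simps del: of_nat_Suc)
    have ge_0: "0 \<le> T * real k / n" using assms by simp
    have near: "\<bar>f t - f t0\<bar> \<le> C * (T / n) powr \<gamma>" if "t \<in> {0..T}" "\<bar>t - t0\<bar> \<le> T / n" for t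
    proof -
      have "T / n < \<delta>" using n * assms by (simp add: field_simps)
      then have "\<bar>f t - f t0\<bar> \<le> C * \<bar>t - t0\<bar> powr \<gamma>" using *(3) that by auto
      also have "\<dots> \<le> C * (T / n) powr \<gamma>"
        using that * assms by (intro mult_left_mono powr_mono2) auto
      finally show ?thesis .
    qed
    have "\<bar>f (T * real (Suc k) / n) - f (T * real k / n)\<bar>
        \<le> \<bar>f (T * real (Suc k) / n) - f t0\<bar> + \<bar>f (T * real k / n) - f t0\<bar>"
      by linarith
    also have "\<dots> \<le> C * (T / n) powr \<gamma> + C * (T / n) powr \<gamma>"
      using k le_T ge_0 mesh assms(2) by (intro add_mono near) (auto simp del: of_nat_Suc)
    also have "\<dots> = 2 * C * T powr \<gamma> * real n powr - \<gamma>"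
      using assms by (simp add: powr_divide powr_minus field_simps)
    also have "\<dots> \<le> m * real n powr - \<gamma>"
      using m by (intro mult_right_mono) auto
    finally show "\<exists>k<n. \<bar>f (T * real (Suc k) / n) - f (T * real k / n)\<bar> \<le> m * real n powr - \<gamma>"
      using k(1) by blast
  qed
qed

section \<open>Almost sure absence of persistently small grid increments\<close>

text \<open>Union bound over the \<open>n\<close> cells: they all have length \<open>T / n\<close>,
  so the moment formula and Markov's inequality give the same bound for each of them.\<close>

lemma emeasure_small_grid_increment_le:
  fixes X :: "real \<Rightarrow> 'a \<Rightarrow> real" and n :: nat
  assumes "measurable_process M T X" and "0 < T" and "q < 0" and "0 < n" and "0 < \<epsilon>" and "0 \<le> c"
    and moment: "\<And>t s. t \<in> {0..T} \<Longrightarrow> s \<in> {0..T} \<Longrightarrow> t \<noteq> s \<Longrightarrow>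
      abs_moment M (\<lambda>\<omega>. X t \<omega> - X s \<omega>) q = ennreal (c * \<bar>t - s\<bar> powr \<theta>)"
  shows "emeasure M {\<omega> \<in> space M. \<exists>k<n. \<bar>X (T * real (Suc k) / n) \<omega> - X (T * real k / n) \<omega>\<bar> \<le> \<epsilon>}
    \<le> ennreal (n * (\<epsilon> powr - q * (c * (T / n) powr \<theta>)))"
proof -
  let ?D = "\<lambda>k \<omega>. X (T * real (Suc k) / n) \<omega> - X (T * real k / n) \<omega>"
  let ?B = "\<lambda>k. {\<omega> \<in> space M. \<bar>?D k \<omega>\<bar> \<le> \<epsilon>}"
  have grid: "T * real k / n \<in> {0..T}" if "k \<le> n" for k
    using assms that by (auto simp: field_simps)
  have meas: "?D k \<in> borel_measurable M" if "k < n" for k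
    using that grid[of k] grid[of "Suc k"]
    by (intro borel_measurable_diff measurable_process_at[OF assms(1)]) auto
  have B: "emeasure M (?B k) \<le> ennreal (\<epsilon> powr - q * (c * (T / n) powr \<theta>))" if "k < n" for k
  proof -
    have diff: "T * real (Suc k) / n - T * real k / n = T / n"
      by (simp add: distrib_left add_divide_distrib)
    have "T / n > 0" using assms by simp
    then have "abs_moment M (?D k) q = ennreal (c * (T / n) powr \<theta>)"
      using moment[of "T * real (Suc k) / n" "T * real k / n"] grid[of k] grid[of "Suc k"] that
      unfolding diff by (simp add: diff[symmetric] del: of_nat_Suc)
    with emeasure_abs_le_abs_moment[OF meas[OF that] \<open>q < 0\<close> \<open>0 < \<epsilon>\<close>] show ?thesis
      by (simp add: ennreal_mult' del: of_nat_Suc)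
  qed
  have "{\<omega> \<in> space M. \<exists>k<n. \<bar>?D k \<omega>\<bar> \<le> \<epsilon>} = (\<Union>k<n. ?B k)" by auto
  also have "emeasure M \<dots> \<le> (\<Sum>k<n. emeasure M (?B k))"
    using meas by (intro emeasure_subadditive_finite) (auto intro!: borel_measurable_le)
  also have "\<dots> \<le> (\<Sum>k<n. ennreal (\<epsilon> powr - q * (c * (T / n) powr \<theta>)))"
    using B by (intro sum_mono) auto
  also have "\<dots> = ennreal (n * (\<epsilon> powr - q * (c * (T / n) powr \<theta>)))"
    by (simp add: ennreal_mult' ennreal_of_nat_eq_real_of_nat)
  finally show ?thesis .
qed

text \<open>The exceptional event demands a small increment for every \<open>n \<ge> m\<close> at
  once. It is therefore contained in the event for each single \<open>n\<close>, and bounds tending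
  to \<open>0\<close> force its measure to vanish.\<close>

lemma AE_not_all_small_grid_increments:
  fixes X :: "real \<Rightarrow> 'a \<Rightarrow> real" and m :: nat
  assumes "measurable_process M T X" and "0 < T" and "q < 0" and "0 < m" and "0 \<le> c"
    and moment: "\<And>t s. t \<in> {0..T} \<Longrightarrow> s \<in> {0..T} \<Longrightarrow> t \<noteq> s \<Longrightarrow>
      abs_moment M (\<lambda>\<omega>. X t \<omega> - X s \<omega>) q = ennreal (c * \<bar>t - s\<bar> powr \<theta>)"
    and \<gamma>: "\<theta> / q - 1 / q < \<gamma>"
  shows "AE \<omega> in M. \<exists>n\<ge>m. \<forall>k<n. m * real n powr - \<gamma> < \<bar>X (T * real (Suc k) / n) \<omega> - X (T * real k / n) \<omega>\<bar>"
proof -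
  let ?A = "\<lambda>n. {\<omega> \<in> space M. \<exists>k<n. \<bar>X (T * real (Suc k) / n) \<omega> - X (T * real k / n) \<omega>\<bar> \<le> m * real n powr - \<gamma>}"
  let ?N = "\<Inter>n\<in>{m..}. ?A n"
  have meas: "?A n \<in> sets M" if "m \<le> n" for n
  proof -
    have "X (T * real k / n) \<in> borel_measurable M" if "k \<le> n" for k
      using that assms \<open>m \<le> n\<close>
      by (intro measurable_process_at[OF assms(1)]) (auto simp: field_simps)
    then have "(\<Union>k<n. {\<omega> \<in> space M. \<bar>X (T * real (Suc k) / n) \<omega> - X (T * real k / n) \<omega>\<bar> \<le> m * real n powr - \<gamma>}) \<in> sets M"
      by (intro sets.finite_UN borel_measurable_le borel_measurable_abs borel_measurable_diff
          borel_measurable_const) (auto simp del: of_nat_Suc)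
    also have "(\<Union>k<n. {\<omega> \<in> space M. \<bar>X (T * real (Suc k) / n) \<omega> - X (T * real k / n) \<omega>\<bar> \<le> m * real n powr - \<gamma>}) = ?A n"
      by auto
    finally show ?thesis .
  qed
  \<comment> \<open>This is the preceding union bound with
    \<open>\<epsilon> = m * real n powr - \<gamma>\<close>; as a function of \<open>n\<close> it is
    a constant times \<open>real n powr (1 - \<theta> + \<gamma> * q)\<close>.\<close>
  define b where "b n = real n * ((m * real n powr - \<gamma>) powr - q * (c * (T / n) powr \<theta>))" for n :: nat
  have "emeasure M ?N \<le> ennreal (b n)" if "m \<le> n" for n
  proof -
    have "0 < m * real n powr - \<gamma>" using \<open>0 < m\<close> that by simp
    have "emeasure M ?N \<le> emeasure M (?A n)"
      using that by (intro emeasure_mono meas INF_lower) simp_all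
    also have "\<dots> \<le> ennreal (b n)"
      unfolding b_def using assms that \<open>0 < m * real n powr - \<gamma>\<close>
      by (intro emeasure_small_grid_increment_le moment) auto
    finally show ?thesis .
  qed
  moreover have "b \<longlonglongrightarrow> 0"
  proof -
    \<comment> \<open>Multiplying the lower bound on \<open>\<gamma>\<close> by the negative number
      \<open>q\<close> reverses it to \<open>\<gamma> * q < \<theta> - 1\<close>.\<close>
    have "1 - \<theta> + \<gamma> * q < 0" using \<gamma> \<open>q < 0\<close> by (simp add: field_simps)
    then have "(\<lambda>n. real n powr (1 - \<theta> + \<gamma> * q)) \<longlonglongrightarrow> 0"
      by real_asymp
    from tendsto_mult_left[OF this, of "m powr - q * c * T powr \<theta>"]
    have lim: "(\<lambda>n. m powr - q * c * T powr \<theta> * real n powr (1 - \<theta> + \<gamma> * q)) \<longlonglongrightarrow> 0" by simp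
    have "m powr - q * c * T powr \<theta> * real n powr (1 - \<theta> + \<gamma> * q) = b n" if "n > 0" for n
    proof -
      have "(m * real n powr - \<gamma>) powr - q = m powr - q * real n powr (\<gamma> * q)"
        by (simp add: powr_mult powr_powr)
      moreover have "(T / n) powr \<theta> = T powr \<theta> * real n powr - \<theta>"
        using \<open>0 < T\<close> by (simp add: powr_divide powr_minus_divide)
      moreover have "real n powr (1 - \<theta> + \<gamma> * q) = n * real n powr - \<theta> * real n powr (\<gamma> * q)"
        using that powr_add[of "real n" "1 - \<theta>" "\<gamma> * q"] powr_add[of "real n" 1 "- \<theta>"] by simp
      ultimately show ?thesis by (simp only: b_def mult_ac)
    qed
    then have "\<forall>\<^sub>F n in sequentially. m powr - q * c * T powr \<theta> * real n powr (1 - \<theta> + \<gamma> * q) = b n"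
      by (rule eventually_mono[OF eventually_gt_at_top[of 0]])
    with lim show ?thesis
      by (rule Lim_transform_eventually)
  qed
  from tendsto_ennrealI[OF this] have "(\<lambda>n. ennreal (b n)) \<longlonglongrightarrow> 0"
    by simp
  ultimately have "emeasure M ?N \<le> 0"
    by (intro LIMSEQ_le_const[where X = "\<lambda>n. ennreal (b n)"]) (assumption, blast)
  moreover have "?N \<in> sets M"
    by (rule sets.countable_INT') (use meas in blast)+
  ultimately have "?N \<in> null_sets M"
    by (intro null_setsI) (simp_all only: le_zero_eq)
  from AE_not_in[OF this] show ?thesis
  proof (rule AE_mp, intro AE_I2 impI)
    fix \<omega> assume "\<omega> \<in> space M" and "\<omega> \<notin> ?N"
    then obtain n where "m \<le> n" and "\<omega> \<notin> ?A n" by blast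
    with \<open>\<omega> \<in> space M\<close> have "\<forall>k<n. \<not> \<bar>X (T * real (Suc k) / n) \<omega> - X (T * real k / n) \<omega>\<bar>
        \<le> m * real n powr - \<gamma>"
      by blast
    with \<open>m \<le> n\<close> show "\<exists>n\<ge>m. \<forall>k<n.
        m * real n powr - \<gamma> < \<bar>X (T * real (Suc k) / n) \<omega> - X (T * real k / n) \<omega>\<bar>"
      unfolding not_le by blast
  qed
qed

text \<open>One null set must serve uncountably many exponents. It is built from rational exponents
  and natural constants only; any larger real \<open>\<gamma>\<close> reduces to a rational
  \<open>r\<close> below it by \<open>holder_at_mono\<close>.\<close>

lemma AE_nowhere_holder_of_negative_moment:
  fixes X :: "real \<Rightarrow> 'a \<Rightarrow> real"
  assumes "measurable_process M T X" and "0 < T" and "q < 0" and "\<theta> < 1" and "0 \<le> c"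
    and moment: "\<And>t s. t \<in> {0..T} \<Longrightarrow> s \<in> {0..T} \<Longrightarrow> t \<noteq> s \<Longrightarrow>
      abs_moment M (\<lambda>\<omega>. X t \<omega> - X s \<omega>) q = ennreal (c * \<bar>t - s\<bar> powr \<theta>)"
  shows "AE \<omega> in M. \<forall>\<gamma> > \<theta> / q - 1 / q. nowhere_holder T (\<lambda>t. X t \<omega>) \<gamma>"
proof -
  let ?\<gamma>0 = "\<theta> / q - 1 / q"
  \<comment> \<open>Here \<open>\<theta> < 1\<close> enters: every exponent above the threshold is
    positive, as \<open>holder_at_small_grid_increment\<close> requires.\<close>
  have "0 < ?\<gamma>0" using assms by (simp add: field_simps)
  have "AE \<omega> in M. \<forall>\<gamma>\<in>{\<gamma>\<in>\<rat>. ?\<gamma>0 < \<gamma>}. \<forall>m\<in>{0<..}. \<exists>n\<ge>m. \<forall>k<n.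
      real m * real n powr - \<gamma> < \<bar>X (T * real (Suc k) / n) \<omega> - X (T * real k / n) \<omega>\<bar>"
    by (intro AE_ball_countable' AE_not_all_small_grid_increments[OF assms(1-3) _ \<open>0 \<le> c\<close> moment])
       (auto intro: countable_subset[OF _ countable_rat])
  then show ?thesis
  proof (rule AE_mp, intro AE_I2 impI allI)
    fix \<omega> \<gamma>
    assume *: "\<forall>\<gamma>\<in>{\<gamma>\<in>\<rat>. ?\<gamma>0 < \<gamma>}. \<forall>m\<in>{0<..}. \<exists>n\<ge>m. \<forall>k<n.
      real m * real n powr - \<gamma> < \<bar>X (T * real (Suc k) / n) \<omega> - X (T * real k / n) \<omega>\<bar>"
      and "?\<gamma>0 < \<gamma>"
    obtain r where r: "r \<in> \<rat>" "?\<gamma>0 < r" "r < \<gamma>" using Rats_dense_in_real \<open>?\<gamma>0 < \<gamma>\<close> by blast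
    have "\<not> holder_at T (\<lambda>t. X t \<omega>) \<gamma> t0" if "t0 \<in> {0..T}" for t0
    proof
      assume "holder_at T (\<lambda>t. X t \<omega>) \<gamma> t0"
      then have "holder_at T (\<lambda>t. X t \<omega>) r t0" using r by (auto intro: holder_at_mono)
      from holder_at_small_grid_increment[OF this that _ \<open>0 < T\<close>] r \<open>0 < ?\<gamma>0\<close>
      obtain m :: nat where m: "0 < m" "\<And>n. m \<le> n \<Longrightarrow>
          \<exists>k<n. \<bar>X (T * real (Suc k) / n) \<omega> - X (T * real k / n) \<omega>\<bar> \<le> m * real n powr - r"
        by (metis order.strict_trans)
      obtain n where "m \<le> n" and "\<forall>k<n. real m * real n powr - r
          < \<bar>X (T * real (Suc k) / n) \<omega> - X (T * real k / n) \<omega>\<bar>"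
        using * r m(1) by blast
      with m(2) show False by (meson not_le)
    qed
    then show "nowhere_holder T (\<lambda>t. X t \<omega>) \<gamma>" by (simp add: nowhere_holder_def)
  qed
qed

section \<open>Multifractal processes and the pointwise Hoelder exponent\<close>

lemma upper_q_nonneg: "0 \<le> upper_q M T X"
  unfolding upper_q_def Let_def
  by (auto intro!: Sup_upper2[OF imageI])

text \<open>Stated for an arbitrary \<open>q\<close> between \<open>lower_q M T X\<close> and
  \<open>0\<close>, so that it applies both to the given \<open>q\<close> and to every exponent
  competing in \<open>H_plus_tilde\<close>.\<close>

lemma AE_nowhere_holder_multifractal:
  assumes "measurable_process M T X" and "0 < T" and "multifractal_with M T X \<tau>"
    and "q < 0" and "lower_q M T X < ereal q" and "\<tau> q < 1"
  shows "AE \<omega> in M. \<forall>\<gamma> > \<tau> q / q - 1 / q. nowhere_holder T (\<lambda>t. X t \<omega>) \<gamma>"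
proof -
  have "ereal q < upper_q M T X"
    using \<open>q < 0\<close> by (intro less_le_trans[OF _ upper_q_nonneg]) simp
  then have "q \<in> moment_range M T X" using assms by (simp add: moment_range_def)
  then obtain c :: real where "0 \<le> c" and "\<And>t s. t \<in> {0..T} \<Longrightarrow> s \<in> {0..T} \<Longrightarrow> t \<noteq> s \<Longrightarrow>
      abs_moment M (\<lambda>\<omega>. X t \<omega> - X s \<omega>) q = ennreal (c * \<bar>t - s\<bar> powr \<tau> q)"
    using assms(3) unfolding multifractal_with_def by blast
  with assms show ?thesis by (intro AE_nowhere_holder_of_negative_moment) auto
qed

text \<open>The assumption \<open>0 \<le> \<gamma>0\<close> covers paths with no admissible exponent
  at \<open>t\<close>, where \<open>holder_exponent\<close> takes the default value
  \<open>0\<close>.\<close>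

lemma holder_exponent_le:
  assumes "\<forall>\<gamma> > \<gamma>0. nowhere_holder T f \<gamma>" and "0 \<le> \<gamma>0" and "t \<in> {0..T}"
  shows "holder_exponent T f t \<le> ereal \<gamma>0"
proof -
  have "\<gamma> \<le> \<gamma>0" if "holder_at T f \<gamma> t" for \<gamma>
    using assms that unfolding nowhere_holder_def by (meson not_less)
  then show ?thesis
    using assms(2) by (auto simp: holder_exponent_def Let_def intro!: Sup_least)
qed

theorem proposition2:
  fixes M :: "'a measure" and T :: real and X :: "real \<Rightarrow> 'a \<Rightarrow> real"
    and \<tau> :: "real \<Rightarrow> real" and q :: real
  assumes "prob_space M"
    and "0 < T"
    and "measurable_process M T X"
    and "separable_process M T X"
    and "\<not> as_constant_process M T X"
    and "stoch_continuous_at_zero M T X"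
    and "multifractal_with M T X \<tau>"
    and "q < 0"
    and "q \<in> moment_range M T X"
    and "abs_moment M (X T) q < \<infinity>"
    and "\<tau> q < 1"
  shows "(AE \<omega> in M. \<forall>\<gamma> > \<tau> q / q - 1 / q. nowhere_holder T (\<lambda>t. X t \<omega>) \<gamma>) \<and>
         (AE \<omega> in M. \<forall>t\<in>{0..T}. holder_exponent T (\<lambda>t. X t \<omega>) t \<le> H_plus_tilde M T X \<tau>)"
proof
  let ?E = "{ereal (\<tau> q / q - 1 / q) | q. lower_q M T X < ereal q \<and> q < 0 \<and> \<tau> q < 1}"
  have q: "lower_q M T X < ereal q" using assms by (simp add: moment_range_def)
  then show "AE \<omega> in M. \<forall>\<gamma> > \<tau> q / q - 1 / q. nowhere_holder T (\<lambda>t. X t \<omega>) \<gamma>"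
    using assms by (intro AE_nowhere_holder_multifractal) auto
  have "?E \<noteq> {}" using q assms by blast
  \<comment> \<open>The infimum over possibly uncountably many \<open>q\<close> equals that of a
    sequence in \<open>?E\<close>, so only countably many null sets have to be combined. The given
    \<open>q\<close> shows that \<open>?E\<close> is nonempty.\<close>
  obtain u where u: "range u \<subseteq> ?E" and Inf_u: "Inf ?E = (INF i::nat. u i)"
    using Inf_countable_INF[OF \<open>?E \<noteq> {}\<close>] by blast
  have "AE \<omega> in M. \<forall>t\<in>{0..T}. holder_exponent T (\<lambda>t. X t \<omega>) t \<le> u i" for i
  proof -
    have "u i \<in> ?E" using u by blast
    then obtain p where p: "u i = ereal (\<tau> p / p - 1 / p)" "lower_q M T X < ereal p" "p < 0" "\<tau> p < 1"
      by blast
    \<comment> \<open>Numerator \<open>\<tau> p - 1\<close> and denominator \<open>p\<close> are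
      both negative.\<close>
    have "0 \<le> \<tau> p / p - 1 / p" using p by (simp add: field_simps)
    have "AE \<omega> in M. \<forall>\<gamma> > \<tau> p / p - 1 / p. nowhere_holder T (\<lambda>t. X t \<omega>) \<gamma>"
      using assms p by (intro AE_nowhere_holder_multifractal) auto
    then show ?thesis
      unfolding p(1)
      by (rule AE_mp) (intro AE_I2 impI ballI holder_exponent_le \<open>0 \<le> \<tau> p / p - 1 / p\<close>)
  qed
  then have "AE \<omega> in M. \<forall>i. \<forall>t\<in>{0..T}. holder_exponent T (\<lambda>t. X t \<omega>) t \<le> u i"
    by (simp add: AE_all_countable)
  then show "AE \<omega> in M. \<forall>t\<in>{0..T}. holder_exponent T (\<lambda>t. X t \<omega>) t \<le> H_plus_tilde M T X \<tau>"
    unfolding H_plus_tilde_def Inf_u by (rule AE_mp) (auto intro!: AE_I2 INF_greatest)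
qed

end
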